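(* Let $\mathbb{K}$ be a field with $\mathrm{char}\,\mathbb{K}\neq 3$ containing an element $\theta$ with $\theta^3=1\neq\theta$. For $\alpha\in\mathbb{K}^*$ let $B^\alpha=Q^{1,-\alpha,0}$ be the quantum polynomial algebra given by generators $x,y,z$ and the relations $xy=\alpha yx$, $zx=\alpha xz$ and $yz=\alpha zy$. Then: (1) for every $(p,q,r)\in M_2$, the Sklyanin algebra $Q^{p,q,r}$ is isomorphic to $B^\alpha$ for some $\alpha\in\mathbb{K}^*$; (2) for $\alpha,\beta\in\mathbb{K}^*$, the algebras $B^\alpha$ and $B^\beta$ are isomorphic if and only if either $\alpha=\beta$ or $\alpha\beta=1$; (3) if $(p,q,r)\in M_2$ and $(p',q',r')\in M_1$, then $Q^{p,q,r}$ and $Q^{p',q',r'}$ are non-isomorphic.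
   Context: For $(p,q,r)\in\mathbb{K}^3$, the Sklyanin algebra $Q^{p,q,r}$ is the associative unital $\mathbb{K}$-algebra with generators $x,y,z$ and relations $pyz+qzy+rxx=0$, $pzx+qxz+ryy=0$, $pxy+qyx+rzz=0$, graded by degree. Isomorphism means isomorphism of graded $\mathbb{K}$-algebras (given by an invertible linear change of the generators). $\mathbb{K}^*=\mathbb{K}\setminus\{0\}$. Define $$M_0=\{(p,q,r)\in\mathbb{K}^3:\ (pq,pr,qr)\neq(0,0,0)\ \text{and}\ (p^3-q^3,p^3-r^3,q^3-r^3)\neq(0,0,0)\},$$ $$M_1=\{(p,q,r)\in\mathbb{K}^3:\ r\neq0,\ (p,q)\neq(0,0),\ (p+q)^3+r^3\neq0\ \text{and}\ (p^3-q^3,p^3-r^3,q^3-r^3)\neq(0,0,0)\},$$ and $M_2=M_0\setminus M_1$. *)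

theory Defs
  imports "HOL-Library.Poly_Mapping" "HOL-Algebra.QuotRing" "HOL-Algebra.Module"
begin

record ('k, 'a) graded_algebra = "('k, 'a) module" +
  component :: "nat \<Rightarrow> 'a set"

text \<open>Isomorphisms of unital algebras, linear over the whole field \<^typ>\<open>'k\<close>, that carry the
  component of degree \<open>n\<close> onto the component of degree \<open>n\<close>.\<close>

definition graded_algebra_iso ::
    "('k, 'a) graded_algebra \<Rightarrow> ('k, 'b) graded_algebra \<Rightarrow> ('a \<Rightarrow> 'b) set" where
  "graded_algebra_iso A B =
     {h \<in> ring_iso A B.
        (\<forall>c. \<forall>a\<in>carrier A. h (c \<odot>\<^bsub>A\<^esub> a) = c \<odot>\<^bsub>B\<^esub> h a) \<and>
        (\<forall>n. h ` component A n = component B n)}"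

definition graded_algebra_isomorphic ::
    "('k, 'a) graded_algebra \<Rightarrow> ('k, 'b) graded_algebra \<Rightarrow> bool" where
  "graded_algebra_isomorphic A B \<longleftrightarrow> graded_algebra_iso A B \<noteq> {}"

text \<open>The quotient of a graded algebra by a two-sided ideal, which is meant to be homogeneous.
  As for \<^const>\<open>rcoset_mult\<close>, the union in the scalar multiplication is over representatives
  and all its members coincide.\<close>

definition graded_quotient ::
    "('k, 'a) graded_algebra \<Rightarrow> 'a set \<Rightarrow> ('k, 'a set) graded_algebra" where
  "graded_quotient A I =
     \<lparr>carrier = carrier (A Quot I), mult = mult (A Quot I), one = one (A Quot I),
      zero = zero (A Quot I), add = add (A Quot I),
      smult = (\<lambda>c X. \<Union>a\<in>X. I +>\<^bsub>A\<^esub> (c \<odot>\<^bsub>A\<^esub> a)),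
      component = (\<lambda>n. (\<lambda>a. I +>\<^bsub>A\<^esub> a) ` component A n)\<rparr>"

text \<open>Words form an additively written, non-commutative monoid under concatenation, so that the
  convolution product of \<^theory>\<open>HOL-Library.Poly_Mapping\<close> is the product of the free algebra.\<close>

datatype 'g word = Word (letters: "'g list")

instantiation word :: (type) monoid_add
begin

definition zero_word :: "'a word" where
  "zero_word = Word []"

definition plus_word :: "'a word \<Rightarrow> 'a word \<Rightarrow> 'a word" where
  "plus_word u v = Word (letters u @ letters v)"

instance
  by standard (simp_all add: zero_word_def plus_word_def)

end

type_synonym ('g, 'k) free_alg = "'g word \<Rightarrow>\<^sub>0 'k"

definition free_algebra :: "('k::field, ('g, 'k) free_alg) graded_algebra" where
  "free_algebra =
     \<lparr>carrier = UNIV, mult = (*), one = 1, zero = 0, add = (+),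
      smult = (\<lambda>c f. Poly_Mapping.single 0 c * f),
      component = (\<lambda>n. {f. \<forall>w\<in>Poly_Mapping.keys f. length (letters w) = n})\<rparr>"

lemma free_algebra_simps [simp]:
  "carrier free_algebra = UNIV"
  "a \<otimes>\<^bsub>free_algebra\<^esub> b = a * b"
  "\<one>\<^bsub>free_algebra\<^esub> = 1"
  "\<zero>\<^bsub>free_algebra\<^esub> = 0"
  "a \<oplus>\<^bsub>free_algebra\<^esub> b = a + b"
  "c \<odot>\<^bsub>free_algebra\<^esub> a = Poly_Mapping.single 0 c * a"
  "component free_algebra n = {f. \<forall>w\<in>Poly_Mapping.keys f. length (letters w) = n}"
  by (simp_all add: free_algebra_def)

lemma ring_free_algebra: "ring (free_algebra :: ('k::field, ('g, 'k) free_alg) graded_algebra)"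
proof -
  have "\<exists>y. y + x = 0 \<and> x + y = 0" for x :: "('g, 'k) free_alg"
    by (rule exI[of _ "- x"]) simp
  then show ?thesis
    by unfold_locales (auto simp: Units_def algebra_simps)
qed

datatype gen = X | Y | Z

definition var :: "gen \<Rightarrow> (gen, 'k::field) free_alg" where
  "var g = Poly_Mapping.single (Word [g]) 1"

definition sklyanin_relations :: "'k::field \<Rightarrow> 'k \<Rightarrow> 'k \<Rightarrow> (gen, 'k) free_alg set" where
  "sklyanin_relations p q r =
    (let x = var X; y = var Y; z = var Z; smul = smult free_algebra in
      {smul p (y * z) + smul q (z * y) + smul r (x * x),
       smul p (z * x) + smul q (x * z) + smul r (y * y),
       smul p (x * y) + smul q (y * x) + smul r (z * z)})"

definition sklyanin_algebra ::
    "'k::field \<Rightarrow> 'k \<Rightarrow> 'k \<Rightarrow> ('k, (gen, 'k) free_alg set) graded_algebra" where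
  "sklyanin_algebra p q r =
     graded_quotient free_algebra (Idl\<^bsub>free_algebra\<^esub> (sklyanin_relations p q r))"

lemma ideal_sklyanin_relations:
  "ideal (Idl\<^bsub>free_algebra\<^esub> (sklyanin_relations p q r)) free_algebra"
  by (rule ring.genideal_ideal[OF ring_free_algebra]) simp

definition quantum_polynomial_algebra ::
    "'k::field \<Rightarrow> ('k, (gen, 'k) free_alg set) graded_algebra" where
  "quantum_polynomial_algebra \<alpha> = sklyanin_algebra 1 (- \<alpha>) 0"

lemma quantum_polynomial_algebra_relations:
  "quantum_polynomial_algebra \<alpha> =
    (let x = var X; y = var Y; z = var Z; smul = smult free_algebra in
      graded_quotient free_algebra (Idl\<^bsub>free_algebra\<^esub>
        {x * y - smul \<alpha> (y * x), z * x - smul \<alpha> (x * z), y * z - smul \<alpha> (z * y)}))"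
proof -
  have neg: "Poly_Mapping.single 0 (- \<alpha>) = - (Poly_Mapping.single 0 \<alpha> :: (gen, 'a) free_alg)"
    by (rule single_uminus)
  have "sklyanin_relations 1 (- \<alpha>) 0 =
    (let x = var X; y = var Y; z = var Z; smul = smult free_algebra in
      {x * y - smul \<alpha> (y * x), z * x - smul \<alpha> (x * z), y * z - smul \<alpha> (z * y)})"
    by (auto simp: sklyanin_relations_def Let_def neg)
  then show ?thesis
    by (simp add: quantum_polynomial_algebra_def sklyanin_algebra_def Let_def)
qed

definition M\<^sub>0 :: "('k::field \<times> 'k \<times> 'k) set" where
  "M\<^sub>0 = {(p, q, r). (p * q, p * r, q * r) \<noteq> (0, 0, 0) \<and>
     (p ^ 3 - q ^ 3, p ^ 3 - r ^ 3, q ^ 3 - r ^ 3) \<noteq> (0, 0, 0)}"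

definition M\<^sub>1 :: "('k::field \<times> 'k \<times> 'k) set" where
  "M\<^sub>1 = {(p, q, r). r \<noteq> 0 \<and> (p, q) \<noteq> (0, 0) \<and> (p + q) ^ 3 + r ^ 3 \<noteq> 0 \<and>
     (p ^ 3 - q ^ 3, p ^ 3 - r ^ 3, q ^ 3 - r ^ 3) \<noteq> (0, 0, 0)}"

definition M\<^sub>2 :: "('k::field \<times> 'k \<times> 'k) set" where
  "M\<^sub>2 = M\<^sub>0 - M\<^sub>1"

end

theory Submission
  imports Defs
begin

text \<open>A graded isomorphism between quotients of the free algebra is a linear substitution \<open>T\<close> of
  the generators that maps the space of quadratic relations of the source into that of the target,
  so everything reduces to linear algebra with \<open>3 \<times> 3\<close> matrices.

  In \<open>M\<^sub>2\<close> with \<open>r \<noteq> 0\<close> the number \<open>- (p + q) / r\<close> is a cube root of unity. Multiplying \<open>z\<close> by a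
  suitable power of it gives \<open>p + q + r = 0\<close>, and then the discrete Fourier transform of the three
  generators removes the squares from the relations. Conversely, if the relations of the target
  contain no squares, the coefficients of the squares of the new generators yield equations for
  each column of \<open>T\<close>: for a source in \<open>M\<^sub>1\<close> these force \<open>T = 0\<close>, and for a source \<open>B\<^sup>\<alpha>\<close> with
  \<open>\<alpha> \<noteq> 1\<close> they force \<open>T\<close> to be monomial. For \<open>\<alpha> = 1\<close> and \<open>\<beta> \<noteq> 1\<close> the mixed coefficients make all
  \<open>2 \<times> 2\<close> minors of \<open>T\<close> vanish.\<close>

section \<open>Substitutions in the free algebra\<close>

text \<open>Left cancellation: for fixed \<open>u\<close> at most one \<open>q\<close> satisfies
  \<open>Word xs = u + q\<close>, and it exists exactly when \<open>u\<close> is a prefix of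
  \<open>xs\<close>.\<close>

lemma Sum_any_when_split_word:
  fixes g :: "'g word \<Rightarrow>\<^sub>0 'k::semiring_0"
  shows "(\<Sum>q. Poly_Mapping.lookup g q when Word xs = u + q) =
    (if take (length (letters u)) xs = letters u
     then Poly_Mapping.lookup g (Word (drop (length (letters u)) xs)) else 0)"
proof (cases "take (length (letters u)) xs = letters u")
  case True
  have "Word xs = u + q \<longleftrightarrow> q = Word (drop (length (letters u)) xs)" for q
    using append_eq_conv_conj[of "letters u" "letters q" xs] True
    by (cases q) (auto simp: plus_word_def eq_commute)
  then show ?thesis
    using True by simp
next
  case False
  then have "Word xs \<noteq> u + q" for q
    by (auto simp: plus_word_def)
  then show ?thesis
    using False by simp
qed

text \<open>Factorizations of a word into two words correspond to its cut positions, so the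
  convolution is a finite sum over them.\<close>

lemma lookup_times_word:
  fixes f g :: "'g word \<Rightarrow>\<^sub>0 'k::semiring_0"
  shows "Poly_Mapping.lookup (f * g) (Word xs) =
    (\<Sum>i\<le>length xs. Poly_Mapping.lookup f (Word (take i xs)) *
      Poly_Mapping.lookup g (Word (drop i xs)))"
proof -
  let ?a = "\<lambda>u. if take (length (letters u)) xs = letters u
    then Poly_Mapping.lookup f u * Poly_Mapping.lookup g (Word (drop (length (letters u)) xs)) else 0"
  let ?A = "(\<lambda>i. Word (take i xs)) ` {..length xs}"
  have "Poly_Mapping.lookup (f * g) (Word xs) = Sum_any ?a"
    unfolding lookup_mult Sum_any_when_split_word by (rule Sum_any.cong) simp
  also have "\<dots> = sum ?a ?A"
  proof (rule Sum_any.expand_superset)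
    \<comment> \<open>Only prefixes of \<open>xs\<close> contribute, and there are finitely many of
      them.\<close>
    show "{u. ?a u \<noteq> 0} \<subseteq> ?A"
    proof
      fix u assume "u \<in> {u. ?a u \<noteq> 0}"
      then have "take (length (letters u)) xs = letters u"
        by (auto split: if_splits)
      then have "u = Word (take (length (letters u)) xs)" "length (letters u) \<le> length xs"
        by (simp, metis length_take min.cobounded1)
      then show "u \<in> ?A"
        by blast
    qed
  qed simp
  also have "\<dots> = (\<Sum>i\<le>length xs. ?a (Word (take i xs)))"
  proof (subst sum.reindex)
    show "inj_on (\<lambda>i. Word (take i xs)) {..length xs}"
      by (rule inj_onI) (metis atMost_iff length_take min.absorb2 word.inject)
  qed simp
  also have "\<dots> = (\<Sum>i\<le>length xs. Poly_Mapping.lookup f (Word (take i xs)) *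
      Poly_Mapping.lookup g (Word (drop i xs)))"
    by (rule sum.cong) (simp_all add: min_def)
  finally show ?thesis .
qed

lemma poly_mapping_sum_single:
  "f = (\<Sum>w\<in>Poly_Mapping.keys f. Poly_Mapping.single w (Poly_Mapping.lookup f w))"
  by (rule poly_mapping_eqI)
    (auto simp: lookup_sum lookup_single when_def in_keys_iff sum.delta)

text \<open>Scalars sit on the empty word, which is neutral on both sides, and the coefficients
  commute.\<close>

lemma scalar_commute:
  fixes f :: "('g, 'k::field) free_alg"
  shows "Poly_Mapping.single 0 c * f = f * Poly_Mapping.single 0 c"
proof -
  have "Poly_Mapping.single 0 c * (\<Sum>w\<in>A. Poly_Mapping.single w (Poly_Mapping.lookup f w)) =
    (\<Sum>w\<in>A. Poly_Mapping.single w (Poly_Mapping.lookup f w)) * Poly_Mapping.single 0 c" for A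
    by (simp add: sum_distrib_left sum_distrib_right mult_single mult.commute)
  from this[of "Poly_Mapping.keys f"] show ?thesis
    by (simp flip: poly_mapping_sum_single)
qed

lemma UNIV_gen: "(UNIV :: gen set) = {X, Y, Z}"
  using gen.exhaust by blast

instance gen :: finite
  by standard (simp add: UNIV_gen)

section \<open>Linear and quadratic forms as coefficient arrays\<close>

definition linear_form :: "(gen \<Rightarrow> 'k) \<Rightarrow> (gen, 'k::field) free_alg" where
  "linear_form v = (\<Sum>g\<in>UNIV. Poly_Mapping.single (Word [g]) (v g))"

definition quadratic_form :: "(gen \<Rightarrow> gen \<Rightarrow> 'k) \<Rightarrow> (gen, 'k::field) free_alg" where
  "quadratic_form m = (\<Sum>g\<in>UNIV. \<Sum>h\<in>UNIV. Poly_Mapping.single (Word [g, h]) (m g h))"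

lemma lookup_linear_form [simp]: "Poly_Mapping.lookup (linear_form v) (Word [g]) = v g"
  by (simp add: linear_form_def lookup_sum lookup_single when_def)

lemma lookup_quadratic_form [simp]:
  "Poly_Mapping.lookup (quadratic_form m) (Word [g, h]) = m g h"
proof -
  have "(\<Sum>a\<in>UNIV. \<Sum>b\<in>UNIV. if a = g \<and> b = h then m a b else 0) =
     (\<Sum>a\<in>UNIV. if a = g then \<Sum>b\<in>UNIV. if b = h then m a b else 0 else 0)"
    by (rule sum.cong) auto
  then show ?thesis
    by (simp add: quadratic_form_def lookup_sum lookup_single when_def)
qed

lemma lookup_quadratic_form_short:
  "length xs \<noteq> 2 \<Longrightarrow> Poly_Mapping.lookup (quadratic_form m) (Word xs) = 0"
  by (auto simp: quadratic_form_def lookup_sum lookup_single when_def intro!: sum.neutral)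

lemma linear_form_times_linear_form:
  "linear_form a * linear_form b = quadratic_form (\<lambda>g h. a g * b h)"
  by (simp add: linear_form_def quadratic_form_def sum_product mult_single plus_word_def)

lemma scalar_times_linear_form:
  "Poly_Mapping.single 0 c * linear_form v = linear_form (\<lambda>g. c * v g)"
  by (simp add: linear_form_def sum_distrib_left mult_single)

lemma scalar_times_quadratic_form:
  "Poly_Mapping.single 0 c * quadratic_form m = quadratic_form (\<lambda>g h. c * m g h)"
  by (simp add: quadratic_form_def sum_distrib_left mult_single)

lemma single_sum: "Poly_Mapping.single w (\<Sum>i\<in>A. c i) = (\<Sum>i\<in>A. Poly_Mapping.single w (c i))"
  by (rule poly_mapping_eqI) (auto simp: lookup_sum lookup_single when_def)

lemma sum_linear_form:
  "(\<Sum>i\<in>A. linear_form (v i)) = linear_form (\<lambda>g. \<Sum>i\<in>A. v i g)"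
  unfolding linear_form_def single_sum by (rule sum.swap)

lemma sum_quadratic_form:
  "(\<Sum>i\<in>A. quadratic_form (m i)) = quadratic_form (\<lambda>g h. \<Sum>i\<in>A. m i g h)"
  unfolding quadratic_form_def single_sum
  by (subst sum.swap, rule sum.cong[OF refl], rule sum.swap)

lemma linear_form_unit: "linear_form (\<lambda>h. if h = g then 1 else 0) = var g"
proof -
  have "Poly_Mapping.single (Word [h]) (if h = g then 1 else 0 :: 'a) =
      (if h = g then Poly_Mapping.single (Word [g]) 1 else 0)" for h
    by simp
  then show ?thesis
    unfolding linear_form_def var_def by (simp only:) simp
qed

text \<open>This turns the image of a generator under a graded map into a row of a matrix.\<close>

lemma degree_one_eq_linear_form:
  fixes f :: "(gen, 'k::field) free_alg"
  assumes "f \<in> component free_algebra 1"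
  shows "f = linear_form (\<lambda>g. Poly_Mapping.lookup f (Word [g]))"
proof (rule poly_mapping_eqI)
  fix w :: "gen word"
  show "Poly_Mapping.lookup f w = Poly_Mapping.lookup (linear_form (\<lambda>g. Poly_Mapping.lookup f (Word [g]))) w"
  proof (cases "length (letters w) = 1")
    case True
    then obtain g where "w = Word [g]"
      by (metis One_nat_def length_0_conv length_Suc_conv word.collapse)
    then show ?thesis
      by simp
  next
    case False
    then have "Poly_Mapping.lookup f w = 0"
      using assms by (auto simp: in_keys_iff)
    moreover have "Poly_Mapping.lookup (linear_form v) w = 0" for v :: "gen \<Rightarrow> 'k"
      using False by (auto simp: linear_form_def lookup_sum lookup_single when_def intro!: sum.neutral)
    ultimately show ?thesis
      by simp
  qed
qed

section \<open>Linear substitutions as algebra endomorphisms\<close>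

definition substitute_word ::
    "(gen \<Rightarrow> gen \<Rightarrow> 'k) \<Rightarrow> gen word \<Rightarrow> (gen, 'k::field) free_alg" where
  "substitute_word T w = prod_list (map (\<lambda>g. linear_form (T g)) (letters w))"

text \<open>Row \<open>g\<close> of \<open>T\<close> holds the image of the generator
  \<open>g\<close>. Hence coefficient vectors are rows multiplied by \<open>T\<close> from the
  right, and applying \<open>T\<close> and then \<open>S\<close> belongs to the matrix product
  \<open>T S\<close>.\<close>

definition substitute ::
    "(gen \<Rightarrow> gen \<Rightarrow> 'k) \<Rightarrow> (gen, 'k) free_alg \<Rightarrow> (gen, 'k::field) free_alg" where
  "substitute T f =
     (\<Sum>w\<in>Poly_Mapping.keys f. Poly_Mapping.single 0 (Poly_Mapping.lookup f w) * substitute_word T w)"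

lemma substitute_word_add: "substitute_word T (u + v) = substitute_word T u * substitute_word T v"
  by (simp add: substitute_word_def plus_word_def)

text \<open>Enlarging the index set beyond the support lets several elements be summed over a common
  set.\<close>

lemma substitute_eq_sum:
  assumes "finite A" "Poly_Mapping.keys f \<subseteq> A"
  shows "substitute T f =
    (\<Sum>w\<in>A. Poly_Mapping.single 0 (Poly_Mapping.lookup f w) * substitute_word T w)"
  unfolding substitute_def using assms
  by (intro sum.mono_neutral_left) (auto simp: in_keys_iff)

lemma substitute_single:
  "substitute T (Poly_Mapping.single w c) = Poly_Mapping.single 0 c * substitute_word T w"
  by (subst substitute_eq_sum[of "{w}"]) simp_all

lemma substitute_zero [simp]: "substitute T 0 = 0"
  by (simp add: substitute_def)

lemma substitute_add: "substitute T (f + g) = substitute T f + substitute T g"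
proof -
  let ?A = "Poly_Mapping.keys f \<union> Poly_Mapping.keys g"
  have "Poly_Mapping.keys (f + g) \<subseteq> ?A"
    by (rule keys_add)
  then show ?thesis
    by (simp add: substitute_eq_sum[of ?A] lookup_add single_add distrib_right sum.distrib)
qed

lemma substitute_sum: "substitute T (\<Sum>i\<in>A. f i) = (\<Sum>i\<in>A. substitute T (f i))"
  by (induction A rule: infinite_finite_induct) (simp_all add: substitute_add)

text \<open>Bilinearity reduces the claim to monomials; there it follows from multiplicativity on
  words and the centrality of scalars.\<close>

lemma substitute_mult: "substitute T (f * g) = substitute T f * substitute T g"
proof -
  let ?s = "\<lambda>f w. Poly_Mapping.single w (Poly_Mapping.lookup f w)"
  have single: "substitute T (?s f u * ?s g v) = substitute T (?s f u) * substitute T (?s g v)" for u v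
  proof -
    let ?c = "Poly_Mapping.single 0 (Poly_Mapping.lookup f u) :: (gen, 'a) free_alg"
    let ?d = "Poly_Mapping.single 0 (Poly_Mapping.lookup g v) :: (gen, 'a) free_alg"
    have "substitute T (?s f u * ?s g v) = (?c * ?d) * (substitute_word T u * substitute_word T v)"
      by (simp add: mult_single substitute_single substitute_word_add)
    also have "\<dots> = ?c * (?d * substitute_word T u) * substitute_word T v"
      by (simp only: mult.assoc)
    also have "\<dots> = (?c * substitute_word T u) * (?d * substitute_word T v)"
      by (simp only: scalar_commute[of "Poly_Mapping.lookup g v" "substitute_word T u"] mult.assoc)
    finally show ?thesis
      by (simp add: substitute_single)
  qed
  have "substitute T ((\<Sum>u\<in>A. ?s f u) * (\<Sum>v\<in>B. ?s g v)) =
      substitute T (\<Sum>u\<in>A. ?s f u) * substitute T (\<Sum>v\<in>B. ?s g v)" for A B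
    by (simp add: sum_distrib_left sum_distrib_right substitute_sum single)
  from this[of "Poly_Mapping.keys f" "Poly_Mapping.keys g"] show ?thesis
    by (simp flip: poly_mapping_sum_single)
qed

lemma substitute_scalar [simp]:
  "substitute T (Poly_Mapping.single 0 c) = Poly_Mapping.single 0 c"
  by (simp add: substitute_single substitute_word_def zero_word_def)

lemma substitute_one [simp]: "substitute T 1 = 1"
  using substitute_scalar[of T 1] by simp

lemma substitute_var [simp]: "substitute T (var g) = linear_form (T g)"
  by (simp add: var_def substitute_single substitute_word_def)

lemma substitute_uminus: "substitute T (- f) = - substitute T f"
  using substitute_add[of T "- f" f] by (simp add: eq_neg_iff_add_eq_0)

lemma substitute_diff: "substitute T (f - g) = substitute T f - substitute T g"
  using substitute_add[of T f "- g"] by (simp add: substitute_uminus)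

lemma substitute_linear_form:
  "substitute T (linear_form v) = linear_form (\<lambda>h. \<Sum>g\<in>UNIV. v g * T g h)"
  by (simp add: linear_form_def[of v] substitute_sum substitute_single substitute_word_def
      scalar_times_linear_form sum_linear_form)

lemma substitute_quadratic_form:
  "substitute T (quadratic_form m) =
    quadratic_form (\<lambda>j k. \<Sum>g\<in>UNIV. \<Sum>h\<in>UNIV. m g h * T g j * T h k)"
  by (simp add: quadratic_form_def[of m] substitute_sum substitute_single substitute_word_def
      linear_form_times_linear_form scalar_times_quadratic_form sum_quadratic_form mult.assoc)

text \<open>Every monomial is a scalar times a product of generators. This is the tool for showing
  that homomorphisms agreeing on generators agree everywhere.\<close>

lemma free_alg_induct [case_names scalar var add mult]:
  fixes f :: "(gen, 'k::field) free_alg"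
  assumes scalar: "\<And>c. P (Poly_Mapping.single 0 c)"
    and var: "\<And>g. P (var g)"
    and add: "\<And>f g. P f \<Longrightarrow> P g \<Longrightarrow> P (f + g)"
    and mult: "\<And>f g. P f \<Longrightarrow> P g \<Longrightarrow> P (f * g)"
  shows "P f"
proof -
  have word: "P (Poly_Mapping.single (Word xs) 1)" for xs
  proof (induction xs)
    case Nil
    then show ?case
      using scalar[of 1] by (simp add: zero_word_def)
  next
    case (Cons g xs)
    have "Poly_Mapping.single (Word (g # xs)) 1 = var g * (Poly_Mapping.single (Word xs) 1 :: (gen, 'k) free_alg)"
      by (simp add: var_def mult_single plus_word_def)
    then show ?case
      using mult[OF var Cons] by simp
  qed
  have single: "P (Poly_Mapping.single w c)" for w c
  proof -
    have "Poly_Mapping.single w c = Poly_Mapping.single 0 c * Poly_Mapping.single (Word (letters w)) 1"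
      by (simp add: mult_single)
    then show ?thesis
      using mult[OF scalar word] by (simp only:)
  qed
  have "P (\<Sum>w\<in>A. Poly_Mapping.single w (Poly_Mapping.lookup f w))" for A
  proof (induction A rule: infinite_finite_induct)
    case (insert w A)
    then show ?case
      using add single by simp
  qed (use scalar[of 0] in simp_all)
  from this[of "Poly_Mapping.keys f"] show ?thesis
    by (simp flip: poly_mapping_sum_single)
qed

lemma substitute_inverse:
  assumes "\<And>g h. (\<Sum>k\<in>UNIV. T g k * S k h) = (if h = g then 1 else 0)"
  shows "substitute S (substitute T f) = f"
  by (induction f rule: free_alg_induct)
    (simp_all add: substitute_add substitute_mult substitute_linear_form assms linear_form_unit)

section \<open>Compatibility of substitutions with the grading\<close>

lemma component_free_algebra_add:
  assumes "f \<in> component free_algebra n" "g \<in> component free_algebra n"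
  shows "f + g \<in> component free_algebra n"
  using assms keys_add[of f g] by auto

lemma component_free_algebra_mult:
  assumes "f \<in> component free_algebra m" "g \<in> component free_algebra n"
  shows "f * g \<in> component free_algebra (m + n)"
  using assms keys_mult[of f g] by (fastforce simp: plus_word_def)

lemma component_free_algebra_sum:
  assumes "\<And>i. i \<in> A \<Longrightarrow> f i \<in> component free_algebra n"
  shows "(\<Sum>i\<in>A. f i) \<in> component free_algebra n"
  using assms
proof (induction A rule: infinite_finite_induct)
  case (insert i A)
  then show ?case
    unfolding sum.insert[OF insert.hyps] by (blast intro: component_free_algebra_add)
qed simp_all

lemma linear_form_in_component: "linear_form v \<in> component free_algebra 1"
  unfolding linear_form_def by (rule component_free_algebra_sum) simp

lemma substitute_word_in_component:
  "substitute_word T w \<in> component free_algebra (length (letters w))"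
proof -
  have "prod_list (map (\<lambda>g. linear_form (T g)) xs) \<in> component free_algebra (length xs)" for xs
  proof (induction xs)
    case Nil
    then show ?case
      by (simp add: zero_word_def)
  next
    case (Cons g xs)
    then show ?case
      using component_free_algebra_mult[OF linear_form_in_component, of _ "length xs" "T g"] by simp
  qed
  then show ?thesis
    by (simp add: substitute_word_def)
qed

lemma substitute_in_component:
  assumes "f \<in> component free_algebra n"
  shows "substitute T f \<in> component free_algebra n"
  unfolding substitute_def
proof (rule component_free_algebra_sum)
  fix w assume "w \<in> Poly_Mapping.keys f"
  then have n: "length (letters w) = n"
    using assms by simp
  have "Poly_Mapping.single 0 (Poly_Mapping.lookup f w) \<in> component free_algebra 0"
    by (simp add: zero_word_def)
  from component_free_algebra_mult[OF this substitute_word_in_component, of T w]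
  show "Poly_Mapping.single 0 (Poly_Mapping.lookup f w) * substitute_word T w \<in> component free_algebra n"
    by (simp only: n add_0)
qed

section \<open>Graded quotients\<close>

text \<open>The inverse is \<open>inv_into\<close> on the carrier of \<open>A\<close>; it is
  controlled only there, so scalar multiples and components have to lie in that carrier.\<close>

lemma graded_algebra_isomorphic_sym:
  assumes "ring A" and smult: "\<And>c a. a \<in> carrier A \<Longrightarrow> c \<odot>\<^bsub>A\<^esub> a \<in> carrier A"
    and comp: "\<And>n. component A n \<subseteq> carrier A"
    and "graded_algebra_isomorphic A B"
  shows "graded_algebra_isomorphic B A"
proof -
  obtain h where h: "h \<in> graded_algebra_iso A B"
    using assms(4) by (auto simp: graded_algebra_isomorphic_def)
  then have iso: "h \<in> ring_iso A B"
    and lin: "\<And>c a. a \<in> carrier A \<Longrightarrow> h (c \<odot>\<^bsub>A\<^esub> a) = c \<odot>\<^bsub>B\<^esub> h a"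
    and deg: "\<And>n. h ` component A n = component B n"
    by (auto simp: graded_algebra_iso_def)
  from iso have bij: "bij_betw h (carrier A) (carrier B)"
    by (rule ring_iso_memE)
  let ?k = "inv_into (carrier A) h"
  have k: "?k (h a) = a" if "a \<in> carrier A" for a
    using bij that by (simp add: bij_betw_inv_into_left)
  have "?k \<in> ring_iso B A"
    by (rule ring_iso_set_sym) fact+
  moreover have "?k (c \<odot>\<^bsub>B\<^esub> b) = c \<odot>\<^bsub>A\<^esub> ?k b" if "b \<in> carrier B" for b c
  proof -
    obtain a where "a \<in> carrier A" "b = h a"
      using \<open>b \<in> carrier B\<close> bij by (auto simp: bij_betw_def)
    then show ?thesis
      using k lin smult by metis
  qed
  moreover have "?k ` component B n = component A n" for n
    using k comp[of n] by (force simp: deg[symmetric] image_image)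
  ultimately show ?thesis
    by (auto simp: graded_algebra_isomorphic_def graded_algebra_iso_def)
qed

lemma graded_algebra_isomorphic_trans:
  assumes "graded_algebra_isomorphic A B" "graded_algebra_isomorphic B C"
  shows "graded_algebra_isomorphic A C"
proof -
  obtain f g where fg: "f \<in> graded_algebra_iso A B" "g \<in> graded_algebra_iso B C"
    using assms by (auto simp: graded_algebra_isomorphic_def)
  then have "f \<in> ring_iso A B" "g \<in> ring_iso B C"
    by (auto simp: graded_algebra_iso_def)
  then have "g \<circ> f \<in> ring_iso A C" "\<And>a. a \<in> carrier A \<Longrightarrow> f a \<in> carrier B"
    by (auto intro: ring_iso_set_trans dest: ring_iso_memE(1))
  moreover have "(g \<circ> f) ` component A n = component C n" for n
    using fg by (simp only: graded_algebra_iso_def mem_Collect_eq image_comp[symmetric])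
  ultimately have "g \<circ> f \<in> graded_algebra_iso A C"
    using fg by (simp add: graded_algebra_iso_def)
  then show ?thesis
    by (auto simp: graded_algebra_isomorphic_def)
qed

section \<open>Arithmetic of cosets in a quotient of the free algebra\<close>

locale free_algebra_ideal = ideal I free_algebra for I :: "('g, 'k::field) free_alg set"
begin

abbreviation coset :: "('g, 'k) free_alg \<Rightarrow> ('g, 'k) free_alg set" where
  "coset f \<equiv> I +>\<^bsub>free_algebra\<^esub> f"

abbreviation quotient :: "('k, ('g, 'k) free_alg set) graded_algebra" where
  "quotient \<equiv> graded_quotient free_algebra I"

lemma add_in_ideal: "f \<in> I \<Longrightarrow> g \<in> I \<Longrightarrow> f + g \<in> I"
  using additive_subgroup.a_closed[OF additive_subgroup_axioms, of f g] by simp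

lemma zero_in_ideal: "0 \<in> I"
  using additive_subgroup.zero_closed[OF additive_subgroup_axioms] by simp

lemma mult_left_in_ideal: "f \<in> I \<Longrightarrow> g * f \<in> I"
  using I_l_closed[of f g] by simp

lemma mult_right_in_ideal: "f \<in> I \<Longrightarrow> f * g \<in> I"
  using I_r_closed[of f g] by simp

lemma uminus_in_ideal: "f \<in> I \<Longrightarrow> - f \<in> I"
  using mult_left_in_ideal[of f "- 1"] by simp

lemma sum_in_ideal: "(\<And>i. i \<in> A \<Longrightarrow> f i \<in> I) \<Longrightarrow> (\<Sum>i\<in>A. f i) \<in> I"
  by (induction A rule: infinite_finite_induct) (simp_all add: add_in_ideal zero_in_ideal)

lemma coset_def: "coset f = {h + f |h. h \<in> I}"
  by (auto simp: a_r_coset_def')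

lemma coset_eq_iff: "coset f = coset g \<longleftrightarrow> f - g \<in> I"
proof
  assume "coset f = coset g"
  then have "f \<in> coset g"
    using zero_in_ideal by (force simp: coset_def)
  then show "f - g \<in> I"
    by (auto simp: coset_def)
next
  have *: "coset f \<subseteq> coset g" if "f - g \<in> I" for f g
  proof
    fix x assume "x \<in> coset f"
    then obtain h where "h \<in> I" "x = h + f"
      by (auto simp: coset_def)
    then have "x = (h + (f - g)) + g" "h + (f - g) \<in> I"
      using that by (simp_all add: add_in_ideal)
    then show "x \<in> coset g"
      unfolding coset_def by blast
  qed
  assume "f - g \<in> I"
  then show "coset f = coset g"
    using *[of f g] *[of g f] uminus_in_ideal[of "f - g"] by auto
qed

lemma coset_eq_self_iff: "coset f = coset 0 \<longleftrightarrow> f \<in> I"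
  by (simp add: coset_eq_iff)

lemma coset_zero: "coset 0 = I"
  by (simp add: coset_def)

lemma quotient_carrier: "carrier quotient = range coset"
  by (auto simp: graded_quotient_def FactRing_def A_RCOSETS_def')

lemma quotient_mult: "coset f \<otimes>\<^bsub>quotient\<^esub> coset g = coset (f * g)"
  using rcoset_mult_add[of f g] by (simp add: graded_quotient_def FactRing_def)

lemma quotient_add: "coset f \<oplus>\<^bsub>quotient\<^esub> coset g = coset (f + g)"
  using a_rcos_sum[of f g] by (simp add: graded_quotient_def FactRing_def)

lemma quotient_one: "\<one>\<^bsub>quotient\<^esub> = coset 1"
  by (simp add: graded_quotient_def FactRing_def)

lemma quotient_zero: "\<zero>\<^bsub>quotient\<^esub> = coset 0"
  by (simp add: graded_quotient_def FactRing_def coset_zero)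

text \<open>Representatives of a coset differ by elements of \<open>I\<close>, which absorbs
  scalars, so all members of the union coincide.\<close>

lemma quotient_smult: "c \<odot>\<^bsub>quotient\<^esub> coset f = coset (Poly_Mapping.single 0 c * f)"
proof -
  have "coset (Poly_Mapping.single 0 c * g) = coset (Poly_Mapping.single 0 c * f)" if "g \<in> coset f" for g
  proof -
    obtain h where "h \<in> I" "g = h + f"
      using \<open>g \<in> coset f\<close> by (auto simp: coset_def)
    then show ?thesis
      by (simp add: coset_eq_iff distrib_left mult_left_in_ideal)
  qed
  moreover have "f \<in> coset f"
    using zero_in_ideal by (force simp: coset_def)
  ultimately have "(\<Union>g\<in>coset f. coset (Poly_Mapping.single 0 c * g)) = coset (Poly_Mapping.single 0 c * f)"
    by (intro SUP_eq_const) blast+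
  then show ?thesis
    by (simp add: graded_quotient_def)
qed

lemma quotient_component: "component quotient n = coset ` component free_algebra n"
  by (simp add: graded_quotient_def)

lemmas quotient_simps =
  quotient_carrier quotient_mult quotient_add quotient_one quotient_zero quotient_smult
  quotient_component

lemma ring_quotient: "ring quotient"
proof (rule ringI)
  show "abelian_group quotient"
  proof (rule abelian_groupI)
    fix x assume "x \<in> carrier quotient"
    then obtain f where "x = coset f"
      by (auto simp: quotient_carrier)
    then have "coset (- f) \<oplus>\<^bsub>quotient\<^esub> x = \<zero>\<^bsub>quotient\<^esub>"
      by (simp add: quotient_simps)
    then show "\<exists>y\<in>carrier quotient. y \<oplus>\<^bsub>quotient\<^esub> x = \<zero>\<^bsub>quotient\<^esub>"
      by (auto simp: quotient_carrier)
  qed (auto simp: quotient_simps algebra_simps)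
  show "Group.monoid quotient"
    by (rule monoidI) (auto simp: quotient_simps mult.assoc)
qed (auto simp: quotient_simps algebra_simps)

lemma isomorphic_quotient_sym:
  "graded_algebra_isomorphic quotient B \<Longrightarrow> graded_algebra_isomorphic B quotient"
  by (rule graded_algebra_isomorphic_sym[OF ring_quotient]) (auto simp: quotient_simps)

end

section \<open>Graded isomorphisms of quotients and linear substitutions\<close>

lemma graded_quotient_isomorphicI:
  fixes I J :: "(gen, 'k::field) free_alg set"
  assumes "ideal I free_algebra" "ideal J free_algebra"
    and TS: "\<And>f. substitute S (substitute T f) = f"
    and ST: "\<And>f. substitute T (substitute S f) = f"
    and IJ: "\<And>f. f \<in> I \<Longrightarrow> substitute T f \<in> J"
    and JI: "\<And>f. f \<in> J \<Longrightarrow> substitute S f \<in> I"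
  shows "graded_algebra_isomorphic (graded_quotient free_algebra I) (graded_quotient free_algebra J)"
proof -
  interpret I: free_algebra_ideal I
    using assms(1) by (simp add: free_algebra_ideal_def)
  interpret J: free_algebra_ideal J
    using assms(2) by (simp add: free_algebra_ideal_def)
  \<comment> \<open>A coset is mapped through a chosen representative; another representative
    differs by an element of \<open>I\<close>, which \<open>T\<close> sends into
    \<open>J\<close>.\<close>
  define h where "h C = J.coset (substitute T (SOME f. I.coset f = C))" for C
  have h: "h (I.coset f) = J.coset (substitute T f)" for f
  proof -
    have "I.coset (SOME g. I.coset g = I.coset f) = I.coset f"
      by (rule someI) (rule refl)
    then have "(SOME g. I.coset g = I.coset f) - f \<in> I"
      by (simp add: I.coset_eq_iff)
    from IJ[OF this] show ?thesis
      by (simp add: h_def J.coset_eq_iff substitute_diff)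
  qed
  \<comment> \<open>Membership is also reflected, because \<open>S\<close> carries \<open>J\<close>
    into \<open>I\<close> and undoes \<open>T\<close>. This gives injectivity.\<close>
  have "substitute T f \<in> J \<longleftrightarrow> f \<in> I" for f
    using IJ JI TS by metis
  then have "inj_on h (range I.coset)"
    by (auto simp: inj_on_def h I.coset_eq_iff J.coset_eq_iff simp flip: substitute_diff)
  moreover have "h ` range I.coset = range J.coset"
  proof -
    have "J.coset f \<in> h ` range I.coset" for f
    proof -
      have "J.coset f = h (I.coset (substitute S f))"
        by (simp add: h ST)
      then show ?thesis
        by (simp only: imageI rangeI)
    qed
    then show ?thesis
      by (auto simp: h)
  qed
  ultimately have "h \<in> ring_iso I.quotient J.quotient"
    by (intro ring_iso_memI)
      (auto simp: I.quotient_simps J.quotient_simps h substitute_add substitute_mult bij_betw_def)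
  moreover have "h ` component I.quotient n = component J.quotient n" for n
  proof -
    have "h ` component I.quotient n = J.coset ` substitute T ` component free_algebra n"
      by (simp add: I.quotient_component image_image h)
    \<comment> \<open>Both substitutions preserve degree, so \<open>S\<close> supplies preimages
      within the same component.\<close>
    also have "substitute T ` component free_algebra n = (component free_algebra n :: (gen, 'k) free_alg set)"
    proof
      show "component free_algebra n \<subseteq> substitute T ` component free_algebra n"
      proof
        fix f :: "(gen, 'k) free_alg" assume "f \<in> component free_algebra n"
        then have "substitute S f \<in> component free_algebra n" "f = substitute T (substitute S f)"
          by (simp_all only: substitute_in_component ST)
        then show "f \<in> substitute T ` component free_algebra n"
          by blast
      qed
    qed (use substitute_in_component in blast)
    finally show ?thesis
      by (simp add: J.quotient_component)
  qed
  ultimately have "h \<in> graded_algebra_iso I.quotient J.quotient"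
    by (auto simp: graded_algebra_iso_def I.quotient_simps J.quotient_simps h substitute_mult)
  then show ?thesis
    by (auto simp: graded_algebra_isomorphic_def)
qed

text \<open>A graded isomorphism sends each generator to the coset of some linear form; these forms
  are the rows of \<open>T\<close>. The isomorphism then agrees with the substitution on all cosets,
  and its injectivity yields the equivalence.\<close>

lemma graded_quotient_isomorphicE:
  fixes I J :: "(gen, 'k::field) free_alg set"
  assumes "ideal I free_algebra" "ideal J free_algebra"
    and "graded_algebra_isomorphic (graded_quotient free_algebra I) (graded_quotient free_algebra J)"
  obtains T where "\<And>f. substitute T f \<in> J \<longleftrightarrow> f \<in> I"
proof -
  interpret I: free_algebra_ideal I
    using assms(1) by (simp add: free_algebra_ideal_def)
  interpret J: free_algebra_ideal J
    using assms(2) by (simp add: free_algebra_ideal_def)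
  obtain h where "h \<in> graded_algebra_iso I.quotient J.quotient"
    using assms(3) by (auto simp: graded_algebra_isomorphic_def)
  then have iso: "h \<in> ring_iso I.quotient J.quotient"
    and lin: "\<And>c a. a \<in> carrier I.quotient \<Longrightarrow> h (c \<odot>\<^bsub>I.quotient\<^esub> a) = c \<odot>\<^bsub>J.quotient\<^esub> h a"
    and deg: "\<And>n. h ` component I.quotient n = component J.quotient n"
    by (auto simp: graded_algebra_iso_def)
  have in_carrier: "I.coset f \<in> carrier I.quotient" for f
    by (simp add: I.quotient_carrier)
  have "\<exists>v. h (I.coset (var g)) = J.coset (linear_form v)" for g
  proof -
    have "I.coset (var g) \<in> component I.quotient 1"
      unfolding I.quotient_component by (rule imageI) (simp add: var_def)
    then have "h (I.coset (var g)) \<in> component J.quotient 1"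
      using deg by blast
    then obtain f where "h (I.coset (var g)) = J.coset f" "f \<in> component free_algebra 1"
      by (auto simp: J.quotient_component)
    then show ?thesis
      using degree_one_eq_linear_form by metis
  qed
  then obtain T where T: "\<And>g. h (I.coset (var g)) = J.coset (linear_form (T g))"
    by metis
  have h: "h (I.coset f) = J.coset (substitute T f)" for f
  proof (induction f rule: free_alg_induct)
    case (scalar c)
    have "h (I.coset 1) = J.coset 1"
      using ring_iso_memE(4)[OF iso] by (simp only: I.quotient_one J.quotient_one)
    then show ?case
      using lin[OF in_carrier, of c 1] by (simp add: I.quotient_smult J.quotient_smult)
  next
    case (var g)
    show ?case
      by (simp add: T)
  next
    case (add f g)
    then show ?case
      using ring_iso_memE(3)[OF iso in_carrier in_carrier, of f g]
      by (simp add: I.quotient_add J.quotient_add substitute_add)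
  next
    case (mult f g)
    then show ?case
      using ring_iso_memE(2)[OF iso in_carrier in_carrier, of f g]
      by (simp add: I.quotient_mult J.quotient_mult substitute_mult)
  qed
  have "substitute T f \<in> J \<longleftrightarrow> f \<in> I" for f
  proof -
    have "substitute T f \<in> J \<longleftrightarrow> h (I.coset f) = h (I.coset 0)"
      by (simp add: h J.coset_eq_self_iff)
    also have "\<dots> \<longleftrightarrow> I.coset f = I.coset 0"
      by (rule inj_on_eq_iff[OF bij_betw_imp_inj_on[OF ring_iso_memE(5)[OF iso]] in_carrier in_carrier])
    finally show ?thesis
      by (simp add: I.coset_eq_self_iff)
  qed
  then show ?thesis
    by (rule that)
qed

text \<open>Closure under negation comes from multiplying by \<open>- 1\<close> on the left.\<close>

lemma free_algebra_idealI:
  fixes I :: "('g, 'k::field) free_alg set"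
  assumes zero: "0 \<in> I" and add: "\<And>f g. f \<in> I \<Longrightarrow> g \<in> I \<Longrightarrow> f + g \<in> I"
    and left: "\<And>f g. f \<in> I \<Longrightarrow> g * f \<in> I" and right: "\<And>f g. f \<in> I \<Longrightarrow> f * g \<in> I"
  shows "ideal I free_algebra"
proof (rule idealI)
  interpret F: ring "free_algebra :: ('k, ('g, 'k) free_alg) graded_algebra"
    by (rule ring_free_algebra)
  show "ring (free_algebra :: ('k, ('g, 'k) free_alg) graded_algebra)"
    by (rule ring_free_algebra)
  show "subgroup I (add_monoid free_algebra)"
  proof (rule subgroup.intro)
    fix f assume "f \<in> I"
    have "a_inv free_algebra f = - f"
      by (rule F.minus_equality) simp_all
    then have "m_inv (add_monoid free_algebra) f = - f"
      by (simp add: a_inv_def)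
    then show "m_inv (add_monoid free_algebra) f \<in> I"
      using left[OF \<open>f \<in> I\<close>, of "- 1"] by simp
  qed (simp_all add: zero add)
qed (simp_all add: left right)

text \<open>Because the preimage is an ideal, an inclusion between images of ideals need only be
  checked on generators.\<close>

lemma ideal_vimage_substitute:
  assumes "ideal J free_algebra"
  shows "ideal {f. substitute T f \<in> J} free_algebra"
proof -
  interpret free_algebra_ideal J
    using assms by (simp add: free_algebra_ideal_def)
  show ?thesis
    by (rule free_algebra_idealI)
      (simp_all add: substitute_add substitute_mult zero_in_ideal add_in_ideal
        mult_left_in_ideal mult_right_in_ideal)
qed

section \<open>Sklyanin algebras\<close>

lemma sum_gen: "(\<Sum>g\<in>UNIV. f g) = f X + f Y + f Z"
  by (simp add: UNIV_gen add.assoc)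

text \<open>The cyclic order of the generators permutes the three relations, so one formula indexed
  by a generator covers them all.\<close>

fun succ_gen :: "gen \<Rightarrow> gen" where
  "succ_gen X = Y"
| "succ_gen Y = Z"
| "succ_gen Z = X"

text \<open>The coefficient of the word \<open>g h\<close> in the relation whose square term is \<open>r i i\<close>.\<close>

definition relation_coeff :: "'k::field \<Rightarrow> 'k \<Rightarrow> 'k \<Rightarrow> gen \<Rightarrow> gen \<Rightarrow> gen \<Rightarrow> 'k" where
  "relation_coeff p q r i g h =
     (if g = succ_gen i \<and> h = succ_gen (succ_gen i) then p
      else if g = succ_gen (succ_gen i) \<and> h = succ_gen i then q
      else if g = i \<and> h = i then r else 0)"

lemma sklyanin_relations_eq:
  "sklyanin_relations p q r = range (\<lambda>i. quadratic_form (relation_coeff p q r i))"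
  unfolding UNIV_gen
  by (simp add: sklyanin_relations_def Let_def quadratic_form_def relation_coeff_def sum_gen
      var_def mult_single plus_word_def zero_word_def ac_simps)

abbreviation sklyanin_ideal :: "'k::field \<Rightarrow> 'k \<Rightarrow> 'k \<Rightarrow> (gen, 'k) free_alg set" where
  "sklyanin_ideal p q r \<equiv> Idl\<^bsub>free_algebra\<^esub> (sklyanin_relations p q r)"

lemma free_algebra_ideal_sklyanin: "free_algebra_ideal (sklyanin_ideal p q r)"
  by (simp add: free_algebra_ideal_def ideal_sklyanin_relations)

section \<open>The relation ideal in degrees at most two\<close>

lemma sklyanin_ideal_minimal:
  assumes "ideal J free_algebra" "\<And>i. quadratic_form (relation_coeff p q r i) \<in> J"
  shows "sklyanin_ideal p q r \<subseteq> J"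
  using assms by (intro ring.genideal_minimal[OF ring_free_algebra]) (auto simp: sklyanin_relations_eq)

lemma relation_in_sklyanin_ideal: "quadratic_form (relation_coeff p q r i) \<in> sklyanin_ideal p q r"
  using ring.genideal_self[OF ring_free_algebra, of "sklyanin_relations p q r"]
  by (auto simp: sklyanin_relations_eq)

lemma combination_in_sklyanin_ideal:
  "quadratic_form (\<lambda>j k. \<Sum>l\<in>UNIV. c l * relation_coeff p q r l j k) \<in> sklyanin_ideal p q r"
proof -
  interpret free_algebra_ideal "sklyanin_ideal p q r"
    by (rule free_algebra_ideal_sklyanin)
  have "(\<Sum>l\<in>UNIV. Poly_Mapping.single 0 (c l) * quadratic_form (relation_coeff p q r l))
      \<in> sklyanin_ideal p q r"
    by (intro sum_in_ideal mult_left_in_ideal relation_in_sklyanin_ideal)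
  then show ?thesis
    by (simp add: scalar_times_quadratic_form sum_quadratic_form)
qed

text \<open>The elements without terms of degree 0 and 1 whose quadratic part lies in the span of
  the relations form an ideal containing the relations. Hence that ideal contains the relation
  ideal.\<close>

lemma sklyanin_ideal_low_degree:
  fixes f :: "(gen, 'k::field) free_alg"
  assumes "f \<in> sklyanin_ideal p q r"
  shows "Poly_Mapping.lookup f (Word []) = 0" "Poly_Mapping.lookup f (Word [g]) = 0"
    "\<exists>c. \<forall>j k. Poly_Mapping.lookup f (Word [j, k]) = (\<Sum>l\<in>UNIV. c l * relation_coeff p q r l j k)"
proof -
  let ?P = "\<lambda>f :: (gen, 'k) free_alg. Poly_Mapping.lookup f (Word []) = 0 \<and>
    (\<forall>g. Poly_Mapping.lookup f (Word [g]) = 0) \<and>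
    (\<exists>c. \<forall>j k. Poly_Mapping.lookup f (Word [j, k]) = (\<Sum>l\<in>UNIV. c l * relation_coeff p q r l j k))"
  have scale: "\<exists>d. \<forall>j k. a * (\<Sum>l\<in>UNIV. c l * relation_coeff p q r l j k) =
      (\<Sum>l\<in>UNIV. d l * relation_coeff p q r l j k)" for a and c :: "gen \<Rightarrow> 'k"
    by (rule exI[of _ "\<lambda>l. a * c l"]) (simp add: sum_distrib_left mult.assoc)
  have "ideal (Collect ?P) free_algebra"
  proof (rule free_algebra_idealI)
    show "0 \<in> Collect ?P"
      by (auto intro!: exI[of _ "\<lambda>_. 0"])
  next
    fix f g assume f: "f \<in> Collect ?P" and g: "g \<in> Collect ?P"
    from f obtain c where "\<forall>j k. Poly_Mapping.lookup f (Word [j, k]) =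
        (\<Sum>l\<in>UNIV. c l * relation_coeff p q r l j k)"
      by blast
    moreover from g obtain d where "\<forall>j k. Poly_Mapping.lookup g (Word [j, k]) =
        (\<Sum>l\<in>UNIV. d l * relation_coeff p q r l j k)"
      by blast
    ultimately have "\<forall>j k. Poly_Mapping.lookup (f + g) (Word [j, k]) =
        (\<Sum>l\<in>UNIV. (c l + d l) * relation_coeff p q r l j k)"
      by (simp add: lookup_add distrib_right sum.distrib)
    then have "\<exists>c. \<forall>j k. Poly_Mapping.lookup (f + g) (Word [j, k]) =
        (\<Sum>l\<in>UNIV. c l * relation_coeff p q r l j k)"
      by (rule exI[of _ "\<lambda>l. c l + d l"])
    with f g show "f + g \<in> Collect ?P"
      by (simp add: lookup_add)
  next
    fix f g assume "f \<in> Collect ?P"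
    then obtain c where f: "Poly_Mapping.lookup f (Word []) = 0" "\<And>g. Poly_Mapping.lookup f (Word [g]) = 0"
      and c: "\<And>j k. Poly_Mapping.lookup f (Word [j, k]) =
        (\<Sum>l\<in>UNIV. c l * relation_coeff p q r l j k)"
      by blast
    \<comment> \<open>Since \<open>f\<close> starts in degree two, only the constant term of
      \<open>g\<close> meets the quadratic part of \<open>f\<close>; the same holds for
      \<open>f * g\<close>.\<close>
    have "Poly_Mapping.lookup (g * f) (Word [j, k]) =
        Poly_Mapping.lookup g (Word []) * (\<Sum>l\<in>UNIV. c l * relation_coeff p q r l j k)" for j k
      by (simp add: lookup_times_word f c mult.commute)
    then have "\<exists>c. \<forall>j k. Poly_Mapping.lookup (g * f) (Word [j, k]) =
        (\<Sum>l\<in>UNIV. c l * relation_coeff p q r l j k)"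
      using scale by (simp only:)
    then show "g * f \<in> Collect ?P"
      by (simp add: lookup_times_word f)
    have "Poly_Mapping.lookup (f * g) (Word [j, k]) =
        Poly_Mapping.lookup g (Word []) * (\<Sum>l\<in>UNIV. c l * relation_coeff p q r l j k)" for j k
      by (simp add: lookup_times_word f c mult.commute)
    then have "\<exists>c. \<forall>j k. Poly_Mapping.lookup (f * g) (Word [j, k]) =
        (\<Sum>l\<in>UNIV. c l * relation_coeff p q r l j k)"
      using scale by (simp only:)
    then show "f * g \<in> Collect ?P"
      by (simp add: lookup_times_word f)
  qed
  moreover have "quadratic_form (relation_coeff p q r i) \<in> Collect ?P" for i
    by (cases i) (auto simp: lookup_quadratic_form_short sum_gen
        intro!: exI[of _ "\<lambda>l. if l = i then 1 else 0"])
  ultimately have "f \<in> Collect ?P"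
    using sklyanin_ideal_minimal assms by blast
  then show "Poly_Mapping.lookup f (Word []) = 0" "Poly_Mapping.lookup f (Word [g]) = 0"
    "\<exists>c. \<forall>j k. Poly_Mapping.lookup f (Word [j, k]) = (\<Sum>l\<in>UNIV. c l * relation_coeff p q r l j k)"
    by blast+
qed

lemma substitute_sklyanin_ideal:
  assumes "\<And>i j k. (\<Sum>g\<in>UNIV. \<Sum>h\<in>UNIV. relation_coeff p q r i g h * T g j * T h k) =
      (\<Sum>l\<in>UNIV. c i l * relation_coeff p' q' r' l j k)"
    and "f \<in> sklyanin_ideal p q r"
  shows "substitute T f \<in> sklyanin_ideal p' q' r'"
proof -
  have "substitute T (quadratic_form (relation_coeff p q r i)) \<in> sklyanin_ideal p' q' r'" for i
    unfolding substitute_quadratic_form assms(1) by (rule combination_in_sklyanin_ideal)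
  with ideal_vimage_substitute[OF ideal_sklyanin_relations]
  have "sklyanin_ideal p q r \<subseteq> {f. substitute T f \<in> sklyanin_ideal p' q' r'}"
    by (intro sklyanin_ideal_minimal) auto
  then show ?thesis
    using assms(2) by blast
qed

lemma sklyanin_isomorphicI:
  assumes "\<And>g h. (\<Sum>k\<in>UNIV. T g k * S k h) = (if h = g then 1 else 0)"
    and "\<And>g h. (\<Sum>k\<in>UNIV. S g k * T k h) = (if h = g then 1 else 0)"
    and "\<And>i j k. (\<Sum>g\<in>UNIV. \<Sum>h\<in>UNIV. relation_coeff p q r i g h * T g j * T h k) =
      (\<Sum>l\<in>UNIV. c i l * relation_coeff p' q' r' l j k)"
    and "\<And>i j k. (\<Sum>g\<in>UNIV. \<Sum>h\<in>UNIV. relation_coeff p' q' r' i g h * S g j * S h k) =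
      (\<Sum>l\<in>UNIV. d i l * relation_coeff p q r l j k)"
  shows "graded_algebra_isomorphic (sklyanin_algebra p q r) (sklyanin_algebra p' q' r')"
  unfolding sklyanin_algebra_def
  using ideal_sklyanin_relations ideal_sklyanin_relations
  by (rule graded_quotient_isomorphicI[where T = T and S = S])
    (auto intro: substitute_inverse substitute_sklyanin_ideal assms)

text \<open>The first property holds because the relation ideal contains no nonzero linear form, the
  second because its quadratic elements are exactly the combinations of the relations.\<close>

lemma sklyanin_isomorphicE:
  fixes p q r p' q' r' :: "'k::field"
  assumes "graded_algebra_isomorphic (sklyanin_algebra p q r) (sklyanin_algebra p' q' r')"
  obtains T :: "gen \<Rightarrow> gen \<Rightarrow> 'k"
  where "\<forall>v. (\<forall>h. (\<Sum>g\<in>UNIV. v g * T g h) = 0) \<longrightarrow> (\<forall>g. v g = 0)"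
    and "\<forall>i. \<exists>c. \<forall>j k. (\<Sum>g\<in>UNIV. \<Sum>h\<in>UNIV. relation_coeff p q r i g h * T g j * T h k) =
      (\<Sum>l\<in>UNIV. c l * relation_coeff p' q' r' l j k)"
proof -
  interpret J: free_algebra_ideal "sklyanin_ideal p' q' r'"
    by (rule free_algebra_ideal_sklyanin)
  obtain T where T: "\<And>f. substitute T f \<in> sklyanin_ideal p' q' r' \<longleftrightarrow> f \<in> sklyanin_ideal p q r"
    using assms ideal_sklyanin_relations unfolding sklyanin_algebra_def
    by (metis graded_quotient_isomorphicE)
  show ?thesis
  proof (rule that; intro allI impI)
    fix v :: "gen \<Rightarrow> 'k" and g
    assume "\<forall>h. (\<Sum>g\<in>UNIV. v g * T g h) = 0"
    then have "substitute T (linear_form v) = linear_form (\<lambda>h. 0)"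
      by (simp add: substitute_linear_form)
    also have "\<dots> = 0"
      by (simp add: linear_form_def)
    finally have "substitute T (linear_form v) = 0" .
    then have "linear_form v \<in> sklyanin_ideal p q r"
      using T[of "linear_form v"] J.zero_in_ideal by simp
    then show "v g = 0"
      using sklyanin_ideal_low_degree(2)[of "linear_form v"] by simp
  next
    fix i
    have "substitute T (quadratic_form (relation_coeff p q r i)) \<in> sklyanin_ideal p' q' r'"
      by (simp add: T relation_in_sklyanin_ideal)
    from sklyanin_ideal_low_degree(3)[OF this]
    show "\<exists>c. \<forall>j k. (\<Sum>g\<in>UNIV. \<Sum>h\<in>UNIV. relation_coeff p q r i g h * T g j * T h k) =
      (\<Sum>l\<in>UNIV. c l * relation_coeff p' q' r' l j k)"
      by (simp add: substitute_quadratic_form)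
  qed
qed

text \<open>Since the matrix \<open>c\<close> is invertible, the inverse substitution need not be checked on the
  relations.\<close>

lemma sklyanin_isomorphic_of_substitution:
  assumes TS: "\<And>g h. (\<Sum>k\<in>UNIV. T g k * S k h) = (if h = g then 1 else 0)"
    and ST: "\<And>g h. (\<Sum>k\<in>UNIV. S g k * T k h) = (if h = g then 1 else 0)"
    and dc: "\<And>g h. (\<Sum>k\<in>UNIV. d g k * c k h) = (if h = g then 1 else 0)"
    and rel: "\<And>i j k. (\<Sum>g\<in>UNIV. \<Sum>h\<in>UNIV. relation_coeff p q r i g h * T g j * T h k) =
      (\<Sum>l\<in>UNIV. c i l * relation_coeff p' q' r' l j k)"
  shows "graded_algebra_isomorphic (sklyanin_algebra p q r) (sklyanin_algebra p' q' r')"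
proof (rule sklyanin_isomorphicI[OF TS ST rel])
  fix i j k
  let ?R = "relation_coeff p q r" and ?R' = "relation_coeff p' q' r'"
  \<comment> \<open>Row \<open>i\<close> of \<open>d\<close> combines the source relations into an
    element that \<open>T\<close> sends to the target relation \<open>i\<close>, as
    \<open>d c\<close> is the identity. Applying \<open>S\<close> then returns this
    combination.\<close>
  let ?f = "quadratic_form (\<lambda>g h. \<Sum>l\<in>UNIV. d i l * ?R l g h)"
  have "(\<Sum>g\<in>UNIV. \<Sum>h\<in>UNIV. (\<Sum>l\<in>UNIV. d i l * ?R l g h) * T g j * T h k) = ?R' i j k" for j k
  proof -
    have "(\<Sum>g\<in>UNIV. \<Sum>h\<in>UNIV. (\<Sum>l\<in>UNIV. d i l * ?R l g h) * T g j * T h k) =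
        (\<Sum>l\<in>UNIV. d i l * (\<Sum>g\<in>UNIV. \<Sum>h\<in>UNIV. ?R l g h * T g j * T h k))"
      by (simp add: sum_gen algebra_simps)
    also have "\<dots> = (\<Sum>m\<in>UNIV. (\<Sum>l\<in>UNIV. d i l * c l m) * ?R' m j k)"
      unfolding rel by (simp add: sum_gen algebra_simps)
    also have "\<dots> = ?R' i j k"
      unfolding dc by (cases i) (simp_all add: sum_gen)
    finally show ?thesis .
  qed
  then have "substitute T ?f = quadratic_form (?R' i)"
    by (simp add: substitute_quadratic_form)
  then have "substitute S (quadratic_form (?R' i)) = ?f"
    using substitute_inverse[of T S ?f] TS by simp
  from arg_cong[OF this, of "\<lambda>f. Poly_Mapping.lookup f (Word [j, k])"]
  show "(\<Sum>g\<in>UNIV. \<Sum>h\<in>UNIV. ?R' i g h * S g j * S h k) = (\<Sum>l\<in>UNIV. d i l * ?R l j k)"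
    by (simp only: substitute_quadratic_form lookup_quadratic_form)
qed

section \<open>Isomorphisms by scaling and permuting the generators\<close>

definition diagonal :: "(gen \<Rightarrow> 'k) \<Rightarrow> gen \<Rightarrow> gen \<Rightarrow> 'k::field" where
  "diagonal a g h = (if h = g then a g else 0)"

lemma diagonal_mult_diagonal:
  assumes "\<And>g. a g * b g = 1"
  shows "(\<Sum>k\<in>UNIV. diagonal a g k * diagonal b k h) = (if h = g then 1 else 0)"
  by (cases g; cases h) (simp_all add: sum_gen diagonal_def assms)

text \<open>Each generator \<open>g\<close> is multiplied by \<open>a g\<close>; the last three
  conditions say that relation \<open>i\<close> becomes \<open>c i\<close> times its target, while
  \<open>b\<close> and \<open>d\<close> are the inverse factors.\<close>

lemma sklyanin_isomorphic_diagonal: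
  assumes "\<And>g. a g * b g = 1" and "\<And>g. c g * d g = 1"
    and "\<And>i. p * a (succ_gen i) * a (succ_gen (succ_gen i)) = c i * p'"
    and "\<And>i. q * a (succ_gen (succ_gen i)) * a (succ_gen i) = c i * q'"
    and "\<And>i. r * a i * a i = c i * r'"
  shows "graded_algebra_isomorphic (sklyanin_algebra p q r) (sklyanin_algebra p' q' r')"
proof (rule sklyanin_isomorphic_of_substitution[where T = "diagonal a" and S = "diagonal b"
      and c = "diagonal c" and d = "diagonal d"])
  fix i j k
  show "(\<Sum>g\<in>UNIV. \<Sum>h\<in>UNIV. relation_coeff p q r i g h * diagonal a g j * diagonal a h k) =
      (\<Sum>l\<in>UNIV. diagonal c i l * relation_coeff p' q' r' l j k)"
    using assms(3-5)[of i]
    by (cases i; cases j; cases k)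
      (simp_all add: sum_gen relation_coeff_def diagonal_def)
qed (rule diagonal_mult_diagonal; simp add: assms mult.commute)+

lemma sklyanin_isomorphic_scale:
  assumes "c \<noteq> 0"
  shows "graded_algebra_isomorphic (sklyanin_algebra (c * p) (c * q) (c * r)) (sklyanin_algebra p q r)"
  by (rule sklyanin_isomorphic_diagonal[where a = "\<lambda>_. 1" and b = "\<lambda>_. 1"
        and c = "\<lambda>_. c" and d = "\<lambda>_. inverse c"]) (simp_all add: assms)

text \<open>Only \<open>z\<close> is multiplied by \<open>t\<close>. Relation \<open>Z\<close>
  acquires \<open>t\<^sup>2\<close> on its square, while the other two acquire \<open>t\<close> on
  their mixed terms, and \<open>t * t\<^sup>2 = 1\<close> makes the new parameters agree.\<close>

lemma sklyanin_isomorphic_cube_root: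
  assumes "t ^ 3 = 1"
  shows "graded_algebra_isomorphic (sklyanin_algebra p q r) (sklyanin_algebra p q (t\<^sup>2 * r))"
proof (rule sklyanin_isomorphic_diagonal)
  let ?a = "\<lambda>s g. if g = Z then s else 1"
  have t: "t * t\<^sup>2 = 1" "t * (t * t) = 1"
    using assms by (simp_all add: power2_eq_square power3_eq_cube mult.assoc)
  show "?a t g * ?a (t\<^sup>2) g = 1" for g
    using t by simp
  show "(if g = Z then 1 else t) * (if g = Z then 1 else t\<^sup>2) = 1" for g
    using t by simp
  fix i :: gen
  show "p * ?a t (succ_gen i) * ?a t (succ_gen (succ_gen i)) = (if i = Z then 1 else t) * p"
    "q * ?a t (succ_gen (succ_gen i)) * ?a t (succ_gen i) = (if i = Z then 1 else t) * q"
    by (cases i; simp)+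
  have "t * (t\<^sup>2 * r) = r"
    using t by (simp flip: mult.assoc)
  then show "r * ?a t i * ?a t i = (if i = Z then 1 else t) * (t\<^sup>2 * r)"
    by (simp add: power2_eq_square)
qed

text \<open>Exchanging \<open>x\<close> and \<open>y\<close> reverses the cyclic order, so
  \<open>p\<close> and \<open>q\<close> trade roles. The permutation matrix \<open>P\<close> is its
  own inverse and also describes how the relations are permuted.\<close>

lemma sklyanin_isomorphic_swap:
  "graded_algebra_isomorphic (sklyanin_algebra p q r) (sklyanin_algebra q p r)"
proof -
  define swap where "swap g = (case g of X \<Rightarrow> Y | Y \<Rightarrow> X | Z \<Rightarrow> Z)" for g
  define P :: "gen \<Rightarrow> gen \<Rightarrow> 'a" where "P g h = (if h = swap g then 1 else 0)" for g h
  have PP: "(\<Sum>k\<in>UNIV. P g k * P k h) = (if h = g then 1 else 0)" for g h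
    by (cases g; cases h) (simp_all add: P_def swap_def sum_gen)
  have "(\<Sum>g\<in>UNIV. \<Sum>h\<in>UNIV. relation_coeff p q r i g h * P g j * P h k) =
      (\<Sum>l\<in>UNIV. P i l * relation_coeff q p r l j k)" for i j k
    by (cases i; cases j; cases k) (simp_all add: P_def swap_def sum_gen relation_coeff_def)
  with PP PP PP show ?thesis
    by (rule sklyanin_isomorphic_of_substitution)
qed

lemma sklyanin_isomorphic_sym:
  "graded_algebra_isomorphic (sklyanin_algebra p q r) B \<Longrightarrow>
    graded_algebra_isomorphic B (sklyanin_algebra p q r)"
  unfolding sklyanin_algebra_def
  by (rule free_algebra_ideal.isomorphic_quotient_sym[OF free_algebra_ideal_sklyanin])

lemma sklyanin_isomorphic_refl:
  "graded_algebra_isomorphic (sklyanin_algebra p q r) (sklyanin_algebra p q r)"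
  using sklyanin_isomorphic_scale[of 1 p q r] by simp

lemma sklyanin_isomorphic_quantum:
  assumes "p \<noteq> 0"
  shows "graded_algebra_isomorphic (sklyanin_algebra p q 0) (quantum_polynomial_algebra (- q / p))"
  using sklyanin_isomorphic_scale[of p 1 "q / p" 0] assms
  by (simp add: quantum_polynomial_algebra_def)

text \<open>The swap turns the parameters \<open>(1, - \<alpha>, 0)\<close> into
  \<open>(- \<alpha>, 1, 0)\<close>, which are proportional to
  \<open>(1, - 1 / \<alpha>, 0)\<close>.\<close>

lemma quantum_isomorphic_inverse:
  assumes "\<alpha> * \<beta> = 1"
  shows "graded_algebra_isomorphic (quantum_polynomial_algebra \<alpha>) (quantum_polynomial_algebra \<beta>)"
proof -
  have "\<alpha> \<noteq> 0" "\<beta> = 1 / \<alpha>"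
    using assms by (auto simp: eq_divide_eq mult.commute)
  then have "graded_algebra_isomorphic (sklyanin_algebra (- \<alpha>) 1 0) (quantum_polynomial_algebra \<beta>)"
    using sklyanin_isomorphic_quantum[of "- \<alpha>" 1] by simp
  then show ?thesis
    unfolding quantum_polynomial_algebra_def[of \<alpha>]
    by (rule graded_algebra_isomorphic_trans[OF sklyanin_isomorphic_swap])
qed

section \<open>Removing squares by the discrete Fourier transform\<close>

lemma three_neq_0:
  assumes "CHAR('k::field) \<noteq> 3"
  shows "(3 :: 'k) \<noteq> 0"
proof
  assume "(3 :: 'k) = 0"
  then have "CHAR('k) dvd 3"
    using of_nat_eq_0_iff_char_dvd[of 3, where 'a = 'k] by simp
  moreover from dvd_imp_le[OF this] assms have "CHAR('k) = 0 \<or> CHAR('k) = 1 \<or> CHAR('k) = 2"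
    by arith
  ultimately show False
    by (elim disjE) simp_all
qed

text \<open>For the two primitive cube roots of unity \<open>a\<close> and \<open>b\<close> this is
  the character table of the group of order three, with \<open>X\<close>, \<open>Y\<close>,
  \<open>Z\<close> as residues 0, 1, 2.\<close>

definition fourier :: "'k \<Rightarrow> 'k \<Rightarrow> gen \<Rightarrow> gen \<Rightarrow> 'k::field" where
  "fourier a b g h = (if g = X \<or> h = X then 1 else if g = h then a else b)"

lemma square_eq_of_sum_prod:
  fixes a b :: "'k::field"
  assumes "a + b = - 1" "a * b = 1"
  shows "a * a = - 1 - a"
proof -
  have "a * a = a * (a + b) - a * b"
    by (simp add: distrib_left)
  then show ?thesis
    by (simp add: assms)
qed

text \<open>Orthogonality of characters: exchanging \<open>a\<close> and \<open>b\<close> inverts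
  the matrix up to the factor 3.\<close>

lemma fourier_mult_fourier:
  fixes a b :: "'k::field"
  assumes "a + b = - 1" "a * b = 1"
  shows "(\<Sum>k\<in>UNIV. fourier a b g k * fourier b a k h) = (if h = g then 3 else 0)"
proof -
  have b: "b = - 1 - a"
    using assms(1) by (simp add: eq_diff_eq add.commute)
  have "a * a = - 1 - a" "b * b = - 1 - b" "b * a = 1"
    using square_eq_of_sum_prod[of a b] square_eq_of_sum_prod[of b a] assms
    by (simp_all add: add.commute mult.commute)
  then show ?thesis
    unfolding sum_gen using assms(2) by (cases g; cases h) (simp_all add: fourier_def, simp_all add: b)
qed

text \<open>With generators read as residues modulo 3, the word \<open>j k\<close> in the
  transformed relation \<open>i\<close> has coefficient
  \<open>a^(i*(j+k)) * (p * a^(j-k) + q * a^(k-j) + r)\<close>. For \<open>j = k\<close> the bracket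
  is \<open>p + q + r = 0\<close>; the cases \<open>k = j + 1\<close> and \<open>k = j - 1\<close>
  give the two new parameters.\<close>

lemma sklyanin_isomorphic_fourier:
  fixes p q r a b :: "'k::field"
  assumes three: "(3 :: 'k) \<noteq> 0" and ab: "a + b = - 1" "a * b = 1" and pqr: "p + q + r = 0"
  shows "graded_algebra_isomorphic (sklyanin_algebra p q r)
    (sklyanin_algebra (p * b + q * a + r) (p * a + q * b + r) 0)"
proof -
  have ba: "b + a = - 1" "b * a = 1"
    using ab by (simp_all add: ac_simps)
  have orth: "(\<Sum>k\<in>UNIV. fourier a b g k * (fourier b a k h / 3)) = (if h = g then 1 else 0)"
    "(\<Sum>k\<in>UNIV. fourier b a g k / 3 * fourier a b k h) = (if h = g then 1 else 0)"
    "(\<Sum>k\<in>UNIV. fourier a b g k / 3 * fourier b a k h) = (if h = g then 1 else 0)" for g h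
    using three fourier_mult_fourier[OF ab, of g h] fourier_mult_fourier[OF ba, of g h]
    by (simp_all flip: sum_divide_distrib)
  have rel: "(\<Sum>g\<in>UNIV. \<Sum>h\<in>UNIV. relation_coeff p q r i g h * fourier a b g j * fourier a b h k) =
      (\<Sum>l\<in>UNIV. fourier b a i l *
        relation_coeff (p * b + q * a + r) (p * a + q * b + r) 0 l j k)" for i j k
  proof -
    have b: "b = - 1 - a" and r: "r = - p - q"
      using ab(1) pqr by (simp_all add: eq_diff_eq eq_neg_iff_add_eq_0 ac_simps)
    \<comment> \<open>After eliminating \<open>b\<close> and \<open>r\<close>, every power of
      \<open>a\<close> reduces to degree at most one, so the 27 coefficient identities become
      comparisons of normal forms; \<open>aax\<close> is the right-nested variant of
      \<open>aa\<close>.\<close>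
    have aa: "a * a = - 1 - a"
      using ab by (rule square_eq_of_sum_prod)
    then have aax: "a * (a * x) = - x - a * x" for x
      by (simp add: left_diff_distrib flip: mult.assoc)
    show ?thesis
      unfolding sum_gen
      by (cases i; cases j; cases k)
        (simp_all add: relation_coeff_def fourier_def b r, simp_all add: algebra_simps aa aax)
  qed
  from orth rel show ?thesis
    by (rule sklyanin_isomorphic_of_substitution)
qed

text \<open>If the coefficient vanished, the two linear equations would force
  \<open>(p, q, r)\<close> to be a multiple of \<open>(1, b, a)\<close>, whose entries have equal
  cubes.\<close>

lemma fourier_coeff_neq_0:
  fixes p q r a b :: "'k::field"
  assumes three: "(3 :: 'k) \<noteq> 0" and ab: "a + b = - 1" "a * b = 1" and pqr: "p + q + r = 0"
    and cubes: "\<not> (p ^ 3 = q ^ 3 \<and> p ^ 3 = r ^ 3)"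
  shows "p * b + q * a + r \<noteq> 0"
proof
  assume eq: "p * b + q * a + r = 0"
  have b: "b = - 1 - a" and r: "r = - p - q"
    using ab(1) pqr by (simp_all add: eq_diff_eq eq_neg_iff_add_eq_0 ac_simps)
  have aa: "a * a = - 1 - a"
    using ab by (rule square_eq_of_sum_prod)
  have "a \<noteq> 1"
  proof
    assume "a = 1"
    with ab have "(1 :: 'k) + 1 = - 1"
      by simp
    then show False
      using three by (simp add: eq_neg_iff_add_eq_0)
  qed
  \<comment> \<open>The product is the assumed vanishing coefficient after eliminating
    \<open>b\<close> and \<open>r\<close>; cancelling \<open>a - 1\<close> solves for
    \<open>q\<close>.\<close>
  have "(a - 1) * (p * (a + 1) + q) = p * (a * a - 1) + q * (a - 1)"
    by (simp add: algebra_simps)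
  also have "\<dots> = 0"
    using eq by (simp add: aa b r algebra_simps)
  finally have "q = - (p * (a + 1))"
    using \<open>a \<noteq> 1\<close> by (simp add: eq_neg_iff_add_eq_0 add.commute)
  then have q: "q = p * b" and r: "r = p * a"
    by (simp_all add: b r algebra_simps)
  have "a ^ 3 = 1" "b ^ 3 = 1"
    using square_eq_of_sum_prod[of a b] square_eq_of_sum_prod[of b a] ab
    by (simp_all add: power3_eq_cube add.commute mult.commute[of b a] left_diff_distrib)
  then show False
    using cubes by (simp add: q r power_mult_distrib)
qed

lemma isomorphic_quantum_if_M\<^sub>2:
  fixes p q r \<theta> :: "'k::field"
  assumes three: "(3 :: 'k) \<noteq> 0" and \<theta>: "\<theta> ^ 3 = 1" "\<theta> \<noteq> 1" and "(p, q, r) \<in> M\<^sub>2"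
  shows "\<exists>\<alpha>. \<alpha> \<noteq> 0 \<and>
    graded_algebra_isomorphic (sklyanin_algebra p q r) (quantum_polynomial_algebra \<alpha>)"
proof (cases "r = 0")
  case True
  \<comment> \<open>For \<open>r = 0\<close> the first condition of \<open>M\<^sub>0\<close> reduces
    to \<open>p * q\<close> being nonzero.\<close>
  then have "p \<noteq> 0" "q \<noteq> 0"
    using assms(4) by (auto simp: M\<^sub>2_def M\<^sub>0_def)
  then show ?thesis
    using sklyanin_isomorphic_quantum[of p q] True by (intro exI[of _ "- q / p"]) simp
next
  case False
  \<comment> \<open>For \<open>r\<close> nonzero, membership in \<open>M\<^sub>0\<close> supplies
    every condition of \<open>M\<^sub>1\<close> except the one on
    \<open>(p + q) ^ 3 + r ^ 3\<close>, so that one must fail.\<close>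
  have cubes: "\<not> (p ^ 3 = q ^ 3 \<and> p ^ 3 = r ^ 3)" and sum: "(p + q) ^ 3 + r ^ 3 = 0"
    using assms(4) False by (auto simp: M\<^sub>2_def M\<^sub>0_def M\<^sub>1_def)
  \<comment> \<open>Multiplying \<open>z\<close> by \<open>s\<^sup>2\<close> replaces \<open>r\<close> by \<open>s\<^sup>4 r = s r = - (p + q)\<close>.\<close>
  define s where "s = - (p + q) / r"
  define r' where "r' = (s\<^sup>2)\<^sup>2 * r"
  have "(p + q) ^ 3 = - (r ^ 3)"
    using sum by (simp add: eq_neg_iff_add_eq_0)
  then have s3: "s ^ 3 = 1"
    using False by (simp add: s_def power_divide del: minus_add_distrib)
  have "(s\<^sup>2)\<^sup>2 = s ^ 3 * s"
    by (simp add: power2_eq_square power3_eq_cube mult.assoc)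
  then have r': "r' = s * r"
    by (simp add: r'_def s3)
  then have pqr: "p + q + r' = 0"
    using False by (simp add: s_def)
  \<comment> \<open>Scaling by the cube root \<open>s\<close> does not change \<open>r ^ 3\<close>.
    The second form, with \<open>p\<close> and \<open>q\<close> exchanged, is for
    \<open>Q\<close>.\<close>
  have cubes': "\<not> (p ^ 3 = q ^ 3 \<and> p ^ 3 = r' ^ 3)" "\<not> (q ^ 3 = p ^ 3 \<and> q ^ 3 = r' ^ 3)"
    using cubes by (auto simp: r' power_mult_distrib s3)
  have "(s\<^sup>2) ^ 3 = 1"
    by (metis s3 power_mult mult.commute power_one)
  then have iso1: "graded_algebra_isomorphic (sklyanin_algebra p q r) (sklyanin_algebra p q r')"
    unfolding r'_def by (rule sklyanin_isomorphic_cube_root)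
  \<comment> \<open>As \<open>\<theta>\<close> differs from 1, it is a root of
    \<open>t^2 + t + 1\<close>; thus \<open>\<theta>\<close> and \<open>\<theta>\<^sup>2\<close>
    serve as \<open>a\<close> and \<open>b\<close>.\<close>
  have "(\<theta> - 1) * (\<theta> + \<theta>\<^sup>2 + 1) = \<theta> ^ 3 - 1"
    by (simp add: power2_eq_square power3_eq_cube algebra_simps)
  then have ab: "\<theta> + \<theta>\<^sup>2 = - 1" "\<theta> * \<theta>\<^sup>2 = 1"
    using \<theta> by (simp_all add: eq_neg_iff_add_eq_0 power2_eq_square power3_eq_cube mult.assoc)
  define P where "P = p * \<theta>\<^sup>2 + q * \<theta> + r'"
  define Q where "Q = p * \<theta> + q * \<theta>\<^sup>2 + r'"
  have "P \<noteq> 0"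
    unfolding P_def using three ab pqr cubes'(1) by (rule fourier_coeff_neq_0)
  have "q * \<theta>\<^sup>2 + p * \<theta> + r' \<noteq> 0"
    using three ab _ cubes'(2) by (rule fourier_coeff_neq_0) (use pqr in \<open>simp add: ac_simps\<close>)
  then have "Q \<noteq> 0"
    by (simp add: Q_def ac_simps)
  have "graded_algebra_isomorphic (sklyanin_algebra p q r') (sklyanin_algebra P Q 0)"
    unfolding P_def Q_def using three ab pqr by (rule sklyanin_isomorphic_fourier)
  then have "graded_algebra_isomorphic (sklyanin_algebra p q r) (quantum_polynomial_algebra (- Q / P))"
    using graded_algebra_isomorphic_trans iso1 sklyanin_isomorphic_quantum[OF \<open>P \<noteq> 0\<close>] by blast
  then show ?thesis
    using \<open>P \<noteq> 0\<close> \<open>Q \<noteq> 0\<close> by (intro exI[of _ "- Q / P"]) simp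
qed

section \<open>Obstructions to isomorphism\<close>

lemma cyclic_products_eq_0:
  fixes a b c r s :: "'k::field"
  assumes "r \<noteq> 0" "s ^ 3 + r ^ 3 \<noteq> 0"
    and abc: "s * b * c + r * a * a = 0" "s * c * a + r * b * b = 0" "s * a * b + r * c * c = 0"
  shows "a = 0"
proof -
  \<comment> \<open>Multiplying each equation by its own variable shows that \<open>r\<close> times
    each of the three cubes equals \<open>- (s * m)\<close>.\<close>
  define m where "m = a * b * c"
  have "r * a ^ 3 + s * m = a * (s * b * c + r * a * a)" "r * b ^ 3 + s * m = b * (s * c * a + r * b * b)"
    "r * c ^ 3 + s * m = c * (s * a * b + r * c * c)"
    by (simp_all add: m_def power3_eq_cube algebra_simps)
  then have *: "r * a ^ 3 = - (s * m)" "r * b ^ 3 = - (s * m)" "r * c ^ 3 = - (s * m)"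
    using abc by (simp_all add: eq_neg_iff_add_eq_0)
  \<comment> \<open>Multiplying the three identities leaves an equation in \<open>m\<close> alone,
    with coefficient \<open>s ^ 3 + r ^ 3\<close>.\<close>
  have "r ^ 3 * m ^ 3 = (r * a ^ 3) * (r * b ^ 3) * (r * c ^ 3)"
    by (simp add: m_def power_mult_distrib power3_eq_cube[of r] mult_ac)
  also have "\<dots> = - (s ^ 3 * m ^ 3)"
    unfolding * by (simp add: power3_eq_cube mult_ac)
  finally have "(s ^ 3 + r ^ 3) * m ^ 3 = 0"
    by (simp add: distrib_right)
  then have "m = 0"
    using assms(2) by simp
  then show ?thesis
    using *(1) assms(1) by simp
qed

lemma sum_relation_coeff:
  "(\<Sum>g\<in>UNIV. \<Sum>h\<in>UNIV. relation_coeff p q r i g h * A g * B h) =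
    p * A (succ_gen i) * B (succ_gen (succ_gen i)) + q * A (succ_gen (succ_gen i)) * B (succ_gen i) +
    r * A i * B i"
  unfolding sum_gen by (cases i) (simp_all add: relation_coeff_def)

text \<open>A zero row would be the image of a unit vector under a map with trivial kernel.\<close>

lemma injective_row_neq_0:
  assumes "\<forall>v. (\<forall>h. (\<Sum>g\<in>UNIV. v g * T g h) = 0) \<longrightarrow> (\<forall>g. v g = (0 :: 'k::field))"
  shows "\<exists>h. T g h \<noteq> 0"
proof (rule ccontr)
  assume "\<nexists>h. T g h \<noteq> 0"
  then have "(\<Sum>k\<in>UNIV. (if k = g then 1 else 0) * T k h) = 0" for h
    by (intro sum.neutral) simp
  then have "(if g = g then 1 else 0 :: 'k) = 0"
    using assms[THEN spec, of "\<lambda>k. if k = g then 1 else 0"] by blast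
  then show False
    by simp
qed

lemma not_isomorphic_relation_coeff_0:
  fixes p q r :: "'k::field"
  assumes "r \<noteq> 0" "(p + q) ^ 3 + r ^ 3 \<noteq> 0"
  shows "\<not> graded_algebra_isomorphic (sklyanin_algebra p q r) (sklyanin_algebra p' q' 0)"
proof
  assume "graded_algebra_isomorphic (sklyanin_algebra p q r) (sklyanin_algebra p' q' 0)"
  then obtain T :: "gen \<Rightarrow> gen \<Rightarrow> 'k"
    where inj: "\<forall>v. (\<forall>h. (\<Sum>g\<in>UNIV. v g * T g h) = 0) \<longrightarrow> (\<forall>g. v g = 0)"
    and rel: "\<forall>i. \<exists>c. \<forall>j k. (\<Sum>g\<in>UNIV. \<Sum>h\<in>UNIV. relation_coeff p q r i g h * T g j * T h k) =
      (\<Sum>l\<in>UNIV. c l * relation_coeff p' q' 0 l j k)"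
    by (rule sklyanin_isomorphicE)
  \<comment> \<open>No target relation contains a square, so the coefficient of the word
    \<open>j j\<close> vanishes. Column \<open>j\<close> of \<open>T\<close> thus solves the cyclic
    system with \<open>s = p + q\<close>.\<close>
  have diag: "(p + q) * T (succ_gen i) j * T (succ_gen (succ_gen i)) j + r * T i j * T i j = 0" for i j
  proof -
    obtain c where "\<forall>j k. (\<Sum>g\<in>UNIV. \<Sum>h\<in>UNIV. relation_coeff p q r i g h * T g j * T h k) =
      (\<Sum>l\<in>UNIV. c l * relation_coeff p' q' 0 l j k)"
      using rel by blast
    then have "(\<Sum>g\<in>UNIV. \<Sum>h\<in>UNIV. relation_coeff p q r i g h * T g j * T h j) =
        (\<Sum>l\<in>UNIV. c l * relation_coeff p' q' 0 l j j)"
      by blast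
    also have "\<dots> = 0"
      unfolding sum_gen by (cases j) (simp_all add: relation_coeff_def)
    finally show ?thesis
      unfolding sum_relation_coeff by (simp add: algebra_simps)
  qed
  have "T X h = 0" for h
    by (rule cyclic_products_eq_0[OF assms, of "T Y h" "T Z h"])
      (use diag[of X h] diag[of Y h] diag[of Z h] in simp_all)
  then show False
    using injective_row_neq_0[OF inj, of X] by blast
qed

lemma quantum_isomorphic_imp:
  fixes \<alpha> \<beta> :: "'k::field"
  assumes "graded_algebra_isomorphic (quantum_polynomial_algebra \<alpha>) (quantum_polynomial_algebra \<beta>)"
  shows "\<alpha> = \<beta> \<or> \<alpha> * \<beta> = 1"
proof -
  obtain T :: "gen \<Rightarrow> gen \<Rightarrow> 'k"
    where inj: "\<forall>v. (\<forall>h. (\<Sum>g\<in>UNIV. v g * T g h) = 0) \<longrightarrow> (\<forall>g. v g = 0)"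
    and rel: "\<forall>i. \<exists>c. \<forall>j k. (\<Sum>g\<in>UNIV. \<Sum>h\<in>UNIV. relation_coeff 1 (- \<alpha>) 0 i g h * T g j * T h k) =
      (\<Sum>l\<in>UNIV. c l * relation_coeff 1 (- \<beta>) 0 l j k)"
    using assms unfolding quantum_polynomial_algebra_def by (rule sklyanin_isomorphicE)
  \<comment> \<open>\<open>M\<close> is the coefficient matrix of the image of the relation
    \<open>yz = \<alpha> zy\<close>.\<close>
  define M where "M j k = T Y j * T Z k - \<alpha> * T Z j * T Y k" for j k
  obtain c where "\<forall>j k. (\<Sum>g\<in>UNIV. \<Sum>h\<in>UNIV. relation_coeff 1 (- \<alpha>) 0 X g h * T g j * T h k) =
      (\<Sum>l\<in>UNIV. c l * relation_coeff 1 (- \<beta>) 0 l j k)"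
    using rel by blast
  then have c: "M j k = (\<Sum>l\<in>UNIV. c l * relation_coeff 1 (- \<beta>) 0 l j k)" for j k
    by (simp add: sum_relation_coeff M_def)
  have diag: "M j j = 0" for j
    unfolding c sum_gen by (cases j) (simp_all add: relation_coeff_def)
  \<comment> \<open>The two words occurring in the target relation \<open>l\<close> appear in no
    other target relation, so their coefficients keep the ratio \<open>- \<beta>\<close>.\<close>
  have swap: "M (succ_gen (succ_gen l)) (succ_gen l) = - \<beta> * M (succ_gen l) (succ_gen (succ_gen l))" for l
    unfolding c sum_gen by (cases l) (simp_all add: relation_coeff_def)
  obtain j k where jk: "T Y j \<noteq> 0" "T Z k \<noteq> 0"
    using injective_row_neq_0[OF inj] by blast
  show ?thesis
  proof (cases "\<alpha> = 1")
    case False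
    \<comment> \<open>The diagonal entry is \<open>(1 - \<alpha>) * T Y h * T Z h\<close>, so rows
      \<open>Y\<close> and \<open>Z\<close> have disjoint supports.\<close>
    have "T Y h * T Z h = 0" for h
      using diag[of h] False by (simp add: M_def mult.assoc mult.commute[of "T Z h"])
    then have zero: "T Z j = 0" "T Y k = 0"
      using jk by force+
    then have "M j k = T Y j * T Z k" "M k j = - \<alpha> * (T Y j * T Z k)"
      by (simp_all add: M_def)
    \<comment> \<open>The indices \<open>j\<close> and \<open>k\<close> are distinct, hence cyclic
      neighbours in one of two orders. Comparing the ratios \<open>- \<alpha>\<close> and
      \<open>- \<beta>\<close> gives \<open>\<alpha> = \<beta>\<close> in one order and
      \<open>\<alpha> * \<beta> = 1\<close> in the other.\<close>
    moreover have "M k j = - \<beta> * M j k \<or> M j k = - \<beta> * M k j"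
      using swap[of X] swap[of Y] swap[of Z] jk zero by (cases j; cases k) auto
    ultimately show ?thesis
      using jk by (auto simp: mult.commute[of \<beta>])
  next
    case True
    show ?thesis
    proof (rule ccontr)
      assume "\<not> ?thesis"
      then have "\<beta> \<noteq> 1"
        using True by simp
      have anti: "M h i = - M i h" for h i
        by (simp add: M_def True)
      \<comment> \<open>The antisymmetry of \<open>M\<close> and the ratio \<open>- \<beta>\<close>
        are compatible only for zero entries when \<open>\<beta>\<close> is not 1.\<close>
      have "M (succ_gen l) (succ_gen (succ_gen l)) = 0" for l
        using swap[of l] anti[of "succ_gen (succ_gen l)" "succ_gen l"] \<open>\<beta> \<noteq> 1\<close> by simp
      from this[of X] this[of Y] this[of Z] have "M j h = 0" for h
        using anti[of Z Y] anti[of X Z] anti[of Y X] diag by (cases j; cases h) simp_all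
      \<comment> \<open>The vanishing row \<open>j\<close> of \<open>M\<close> is a linear
        dependence between rows \<open>Y\<close> and \<open>Z\<close> of \<open>T\<close>; it is
        nontrivial because \<open>T Y j\<close> is nonzero.\<close>
      then have "(\<Sum>g\<in>UNIV. (if g = Y then T Z j else if g = Z then - T Y j else 0) * T g h) = 0" for h
        by (simp add: sum_gen M_def True)
      then have "(if Z = Y then T Z j else if Z = Z then - T Y j else 0) = 0"
        using inj[THEN spec, of "\<lambda>g. if g = Y then T Z j else if g = Z then - T Y j else 0"] by blast
      then show False
        using jk by simp
    qed
  qed
qed

theorem lemma5p5:
  fixes \<theta> :: "'k::field"
  assumes "CHAR('k) \<noteq> 3" and "\<theta> ^ 3 = 1" and "\<theta> \<noteq> 1"
  shows "(\<forall>p q r :: 'k. (p, q, r) \<in> M\<^sub>2 \<longrightarrow>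
            (\<exists>\<alpha>. \<alpha> \<noteq> 0 \<and>
              graded_algebra_isomorphic (sklyanin_algebra p q r) (quantum_polynomial_algebra \<alpha>)))
       \<and> (\<forall>\<alpha> \<beta> :: 'k. \<alpha> \<noteq> 0 \<and> \<beta> \<noteq> 0 \<longrightarrow>
            (graded_algebra_isomorphic (quantum_polynomial_algebra \<alpha>) (quantum_polynomial_algebra \<beta>)
              \<longleftrightarrow> \<alpha> = \<beta> \<or> \<alpha> * \<beta> = 1))
       \<and> (\<forall>p q r p' q' r' :: 'k. (p, q, r) \<in> M\<^sub>2 \<and> (p', q', r') \<in> M\<^sub>1 \<longrightarrow>
            \<not> graded_algebra_isomorphic (sklyanin_algebra p q r) (sklyanin_algebra p' q' r'))"
proof (intro conjI allI impI iffI)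
  note to_quantum = isomorphic_quantum_if_M\<^sub>2[OF three_neq_0[OF assms(1)] assms(2,3)]
  {
    fix p q r :: 'k
    assume "(p, q, r) \<in> M\<^sub>2"
    then show "\<exists>\<alpha>. \<alpha> \<noteq> 0 \<and>
        graded_algebra_isomorphic (sklyanin_algebra p q r) (quantum_polynomial_algebra \<alpha>)"
      by (rule to_quantum)
  next
    fix \<alpha> \<beta> :: 'k
    assume "graded_algebra_isomorphic (quantum_polynomial_algebra \<alpha>) (quantum_polynomial_algebra \<beta>)"
    then show "\<alpha> = \<beta> \<or> \<alpha> * \<beta> = 1"
      by (rule quantum_isomorphic_imp)
  next
    fix \<alpha> \<beta> :: 'k
    assume "\<alpha> = \<beta> \<or> \<alpha> * \<beta> = 1"
    then show "graded_algebra_isomorphic (quantum_polynomial_algebra \<alpha>) (quantum_polynomial_algebra \<beta>)"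
      using quantum_isomorphic_inverse sklyanin_isomorphic_refl
      unfolding quantum_polynomial_algebra_def by blast
  next
    fix p q r p' q' r' :: 'k
    assume M: "(p, q, r) \<in> M\<^sub>2 \<and> (p', q', r') \<in> M\<^sub>1"
    then obtain \<alpha> where \<alpha>: "graded_algebra_isomorphic (sklyanin_algebra p q r) (sklyanin_algebra 1 (- \<alpha>) 0)"
      using to_quantum unfolding quantum_polynomial_algebra_def by blast
    show "\<not> graded_algebra_isomorphic (sklyanin_algebra p q r) (sklyanin_algebra p' q' r')"
    proof
      assume "graded_algebra_isomorphic (sklyanin_algebra p q r) (sklyanin_algebra p' q' r')"
      \<comment> \<open>Inverting the supposed isomorphism and composing it with the one onto
        \<open>B\<close> with parameter \<open>\<alpha>\<close> makes the algebra from
        \<open>M\<^sub>1\<close> the source and a presentation without squares the target, as the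
        obstruction requires.\<close>
      then have "graded_algebra_isomorphic (sklyanin_algebra p' q' r') (sklyanin_algebra 1 (- \<alpha>) 0)"
        by (rule graded_algebra_isomorphic_trans[OF sklyanin_isomorphic_sym \<alpha>])
      moreover have "r' \<noteq> 0" "(p' + q') ^ 3 + r' ^ 3 \<noteq> 0"
        using M by (auto simp: M\<^sub>1_def)
      ultimately show False
        using not_isomorphic_relation_coeff_0 by blast
    qed
  }
qed

end
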